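(* Let $A\in\mathbb{R}^{n\times n}$ and $c\in\mathbb{R}^{1\times n}$ be such that $(A,c)$ is observable. For $r\in\{1,\dots,n\}$ define $$\tilde A_r := A_{[r]},\qquad \tilde c_r := \left(\mathcal{O}^r\right)_{[r]},\qquad \tilde b_r := \left(A^{n-r}\left(\mathcal{O}^n\right)^{-1}\begin{pmatrix}0\\ I_r\end{pmatrix}\right)_{[r]}.$$ Suppose that $(\tilde A_r,\tilde b_r,\tilde c_r)$ is strictly externally positive for all $r\in\{1,\dots,n-1\}$, and that $(\tilde A_n,\tilde b_n,\tilde c_n)$ is externally positive with $\tilde c_n\tilde A_n^{l-1}\tilde b_n>0$ for all $l\in\{1,\dots,n-1\}$. Then the observability operator $\mathcal{O}$ of $(A,c)$ is $(n-1)$-variation bounding.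
   Context: Observability: for $A\in\mathbb{R}^{n\times n}$, $c\in\mathbb{R}^{1\times n}$, the observability operator $\mathcal{O}=\mathcal{O}(A,c):\mathbb{R}^n\to\mathbb{R}^{\mathbb{Z}_{\ge 0}}$ is $(\mathcal{O}x_0)(t):=cA^tx_0$, $t\ge 0$. For $t\ge1$, $\mathcal{O}^t\in\mathbb{R}^{t\times n}$ is the matrix with rows $c, cA,\dots,cA^{t-1}$ (in this order). $(A,c)$ is observable if $\mathcal{O}^n$ is invertible. Compound matrices: for $X\in\mathbb{R}^{p\times q}$ and $1\le r\le\min\{p,q\}$, $X_{[r]}\in\mathbb{R}^{\binom{p}{r}\times\binom{q}{r}}$ is the $r$-th multiplicative compound matrix: its entries are the $r\times r$ minors $\det X_{I,J}$, where the row index sets $I\subset\{1,\dots,p\}$ and the column index sets $J\subset\{1,\dots,q\}$ of cardinality $r$ (listed increasingly) are ordered lexicographically. External positivity: a triple $(\tilde A,\tilde b,\tilde c)$ (square matrix, column vector, row vector of compatible sizes) is externally positive if $\tilde c\tilde A^{t-1}\tilde b\ge0$ for all integers $t\ge1$, and strictly externally positive if $\tilde c\tilde A^{t-1}\tilde b>0$ for all integers $t\ge1$. Variation: for a real vector or sequence $u\neq0$, $S^-(u)$ is the number of sign changes in $u$ after deleting all zero entries, and $S^-(0):=-1$. A linear map $u\mapsto Xu$ is $k$-variation bounding ($k\in\mathbb{Z}_{\ge0}$) if $S^-(Xu)\le k$ for all $u\ne0$ with $S^-(u)\le k$. *)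

theory Defs
  imports "HOL-Library.Extended_Real" "Jordan_Normal_Form.Gauss_Jordan_Elimination"
    "Jordan_Normal_Form.Determinant" "Jordan_Normal_Form.DL_Submatrix"
begin

text \<open>Row vectors are \<open>1 \<times> n\<close> matrices and column vectors used as factors are \<open>n \<times> 1\<close> matrices;
  the only entry of a \<open>1 \<times> 1\<close> product is read off at index \<open>(0, 0)\<close>.\<close>

section \<open>Observability\<close>

definition obs_operator :: "real mat \<Rightarrow> real mat \<Rightarrow> real vec \<Rightarrow> nat \<Rightarrow> real" where
  "obs_operator A c x = (\<lambda>t. ((c * (A ^\<^sub>m t)) *\<^sub>v x) $ 0)"

definition obs_matrix :: "real mat \<Rightarrow> real mat \<Rightarrow> nat \<Rightarrow> real mat" where
  "obs_matrix A c t = mat_of_rows (dim_col c) (map (\<lambda>i. row (c * (A ^\<^sub>m i)) 0) [0..<t])"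

definition observable :: "real mat \<Rightarrow> real mat \<Rightarrow> bool" where
  "observable A c \<longleftrightarrow> invertible_mat (obs_matrix A c (dim_row A))"


section \<open>Multiplicative compound matrices\<close>

text \<open>Row and column indices start at 0. The index sets are represented by increasing lists;
  \<open>index_sets_lex\<close> below shows that they come in lexicographic order.\<close>

definition index_sets :: "nat \<Rightarrow> nat \<Rightarrow> nat list list" where
  "index_sets p r = filter (\<lambda>I. length I = r) (subseqs [0..<p])"

definition compound :: "nat \<Rightarrow> real mat \<Rightarrow> real mat" where
  "compound r X = mat (dim_row X choose r) (dim_col X choose r)
     (\<lambda>(i, j). det (submatrix X (set (index_sets (dim_row X) r ! i))
                                (set (index_sets (dim_col X) r ! j))))"

lemma set_subseqs_sorted:
  "sorted_wrt (<) (xs :: nat list) \<Longrightarrow>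
   set (subseqs xs) = {ys. sorted_wrt (<) ys \<and> set ys \<subseteq> set xs}"
proof (induction xs)
  case (Cons x xs)
  have *: "ys \<in> Cons x ` set (subseqs xs) \<union> set (subseqs xs)"
    if "sorted_wrt (<) ys" "set ys \<subseteq> set (x # xs)" for ys
  proof (cases ys)
    case (Cons y zs)
    show ?thesis
    proof (cases "y = x")
      case True
      with that Cons have "zs \<in> set (subseqs xs)"
        using Cons.IH Cons.prems by (auto simp: subset_iff)
      then show ?thesis using True Cons by simp
    next
      case False
      with Cons Cons.prems that have "set ys \<subseteq> set xs"
        by (auto dest!: less_asym)
      then show ?thesis using that Cons.IH Cons.prems by auto
    qed
  qed (use Cons in auto)
  show ?case
  proof (intro equalityI subsetI)
    fix ys assume "ys \<in> {ys. sorted_wrt (<) ys \<and> set ys \<subseteq> set (x # xs)}"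
    then show "ys \<in> set (subseqs (x # xs))"
      using *[of ys] by (simp add: Let_def)
  next
    fix ys assume "ys \<in> set (subseqs (x # xs))"
    then have "ys \<in> Cons x ` set (subseqs xs) \<union> set (subseqs xs)"
      by (simp add: Let_def)
    then show "ys \<in> {ys. sorted_wrt (<) ys \<and> set ys \<subseteq> set (x # xs)}"
      using Cons by (auto simp: subset_iff)
  qed
qed auto

lemma set_index_sets:
  "set (index_sets p r) = {I. sorted_wrt (<) I \<and> set I \<subseteq> {..<p} \<and> length I = r}"
  by (auto simp: index_sets_def set_subseqs_sorted lessThan_atLeast0)

lemma index_sets_lex: "sorted_wrt (\<lambda>I J. (I, J) \<in> lexord {(i, j). i < j}) (index_sets p r)"
proof -
  have "sorted_wrt (\<lambda>I J. (I, J) \<in> lexord {(i, j). i < j}) (filter (\<lambda>I. length I = r) (subseqs xs))"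
    if "sorted_wrt (<) xs" for xs :: "nat list"
    using that
  proof (induction xs arbitrary: r)
    case (Cons x xs)
    have 1: "(x # I, J) \<in> lexord {(i, j). i < j}"
      if "J \<in> set (subseqs xs)" "length J = Suc q" for I J q
    proof -
      have "set J \<subseteq> set xs"
        using that(1) Cons.prems by (simp add: set_subseqs_sorted)
      then show ?thesis using that(2) Cons.prems by (cases J) auto
    qed
    have IH: "sorted_wrt (\<lambda>I J. (I, J) \<in> lexord {(i, j). i < j})
        (filter (\<lambda>I. length I = q) (subseqs xs))" for q
      using Cons by simp
    show ?case
    proof (cases r)
      case 0
      then have "filter (\<lambda>I. length I = r) (subseqs (x # xs)) = filter (\<lambda>I. length I = 0) (subseqs xs)"
        by (simp add: Let_def filter_map o_def)
      then show ?thesis using IH[of 0] by simp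
    next
      case (Suc q)
      have "filter (\<lambda>I. length I = r) (subseqs (x # xs)) =
          map (Cons x) (filter (\<lambda>I. length I = q) (subseqs xs))
          @ filter (\<lambda>I. length I = Suc q) (subseqs xs)"
        by (simp add: Suc Let_def filter_map o_def)
      then show ?thesis
        using IH[of q] IH[of "Suc q"] 1 by (simp add: sorted_wrt_append sorted_wrt_map)
    qed
  qed auto
  then show ?thesis by (simp add: index_sets_def)
qed

lemma length_index_sets: "length (index_sets p r) = p choose r"
proof -
  have d: "distinct (map set (index_sets p r))"
    unfolding index_sets_def
    using distinct_set_subseqs[of "[0..<p]"] by (simp add: distinct_map_filter)
  have "set ` set (index_sets p r) = {K. K \<subseteq> {..<p} \<and> card K = r}"
  proof (intro equalityI subsetI)
    fix K assume "K \<in> {K. K \<subseteq> {..<p} \<and> card K = r}"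
    then show "K \<in> set ` set (index_sets p r)"
      by (intro image_eqI[of _ _ "sorted_list_of_set K"])
        (auto simp: set_index_sets strict_sorted_list_of_set finite_subset[of _ "{..<p}"])
  qed (auto simp: set_index_sets strict_sorted_iff distinct_card)
  then show ?thesis
    using distinct_card[OF d] by (simp add: n_subsets)
qed


section \<open>External positivity\<close>

definition externally_positive :: "real mat \<Rightarrow> real mat \<Rightarrow> real mat \<Rightarrow> bool" where
  "externally_positive A b c \<longleftrightarrow> (\<forall>t\<ge>1. (c * (A ^\<^sub>m (t - 1)) * b) $$ (0, 0) \<ge> 0)"

definition strictly_externally_positive :: "real mat \<Rightarrow> real mat \<Rightarrow> real mat \<Rightarrow> bool" where
  "strictly_externally_positive A b c \<longleftrightarrow> (\<forall>t\<ge>1. (c * (A ^\<^sub>m (t - 1)) * b) $$ (0, 0) > 0)"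

definition A_tilde :: "real mat \<Rightarrow> nat \<Rightarrow> real mat" where
  "A_tilde A r = compound r A"

definition c_tilde :: "real mat \<Rightarrow> real mat \<Rightarrow> nat \<Rightarrow> real mat" where
  "c_tilde A c r = compound r (obs_matrix A c r)"

text \<open>\<open>mat_inverse\<close> returns \<open>Some\<close> inverse for an invertible matrix, which is the only case of
  interest here.\<close>

definition b_tilde :: "real mat \<Rightarrow> real mat \<Rightarrow> nat \<Rightarrow> real mat" where
  "b_tilde A c r = (let n = dim_row A in
     compound r ((A ^\<^sub>m (n - r)) * the (mat_inverse (obs_matrix A c n))
                  * (0\<^sub>m (n - r) r @\<^sub>r 1\<^sub>m r)))"


section \<open>Variation\<close>

text \<open>Vectors and sequences are functions on an index set \<open>I\<close>. After deletion of the zero entries,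
  two entries are adjacent iff all entries strictly between them are zero. A sequence may have
  infinitely many sign changes, hence the extended real value.\<close>

definition sign_changes :: "nat set \<Rightarrow> (nat \<Rightarrow> real) \<Rightarrow> (nat \<times> nat) set" where
  "sign_changes I u = {(i, j). i \<in> I \<and> j \<in> I \<and> i < j \<and> u i * u j < 0 \<and>
                               (\<forall>l\<in>I. i < l \<and> l < j \<longrightarrow> u l = 0)}"

definition variation :: "nat set \<Rightarrow> (nat \<Rightarrow> real) \<Rightarrow> ereal" where
  "variation I u =
     (if \<forall>i\<in>I. u i = 0 then - 1
      else if finite (sign_changes I u) then ereal (real (card (sign_changes I u)))
      else \<infinity>)"

abbreviation vec_variation :: "real vec \<Rightarrow> ereal" where
  "vec_variation u \<equiv> variation {..<dim_vec u} (\<lambda>i. u $ i)"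

abbreviation seq_variation :: "(nat \<Rightarrow> real) \<Rightarrow> ereal" where
  "seq_variation u \<equiv> variation UNIV u"

text \<open>The predicate is meant for linear maps \<open>F\<close> from \<open>\<real>\<close>-vectors of dimension \<open>n\<close> to sequences.\<close>

definition variation_bounding :: "nat \<Rightarrow> nat \<Rightarrow> (real vec \<Rightarrow> nat \<Rightarrow> real) \<Rightarrow> bool" where
  "variation_bounding n k F \<longleftrightarrow>
     (\<forall>u \<in> carrier_vec n. u \<noteq> 0\<^sub>v n \<longrightarrow> vec_variation u \<le> ereal (real k) \<longrightarrow>
        seq_variation (F u) \<le> ereal (real k))"

lemma sign_changes_cong:
  "(\<And>i. i \<in> I \<Longrightarrow> u i = v i) \<Longrightarrow> sign_changes I u = sign_changes I v"
  by (auto simp: sign_changes_def)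

lemma sign_changes_Suc:
  "sign_changes {..<Suc m} u =
     sign_changes {..<m} u \<union> {(i, m) |i. i < m \<and> u i * u m < 0 \<and> (\<forall>l. i < l \<and> l < m \<longrightarrow> u l = 0)}"
  by (auto simp: sign_changes_def less_Suc_eq)

lemma finite_sign_changes: "finite I \<Longrightarrow> finite (sign_changes I u)"
  by (rule finite_subset[of _ "I \<times> I"]) (auto simp: sign_changes_def)

text \<open>For a finite vector this is the count of adjacent entries of opposite sign in the list of
  its nonzero entries.\<close>

lemma card_sign_changes_list:
  fixes xs :: "real list"
  shows "card (sign_changes {..<length xs} (\<lambda>i. xs ! i)) =
         card {k. Suc k < length (filter (\<lambda>x. x \<noteq> 0) xs) \<and>
                  filter (\<lambda>x. x \<noteq> 0) xs ! k * filter (\<lambda>x. x \<noteq> 0) xs ! Suc k < 0}"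
proof (induction xs rule: rev_induct)
  case Nil
  show ?case by (simp add: sign_changes_def)
next
  case (snoc x xs)
  let ?m = "length xs" and ?u = "\<lambda>i. (xs @ [x]) ! i" and ?ys = "filter (\<lambda>x. x \<noteq> 0) xs"
  let ?N = "{(i, ?m) |i. i < ?m \<and> ?u i * ?u ?m < 0 \<and> (\<forall>l. i < l \<and> l < ?m \<longrightarrow> ?u l = 0)}"
  let ?D = "\<lambda>ys :: real list. {k. Suc k < length ys \<and> ys ! k * ys ! Suc k < 0}"
  have S: "sign_changes {..<length (xs @ [x])} ?u = sign_changes {..<?m} (\<lambda>i. xs ! i) \<union> ?N"
  proof -
    have "sign_changes {..<?m} ?u = sign_changes {..<?m} (\<lambda>i. xs ! i)"
      by (rule sign_changes_cong) (simp add: nth_append)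
    then show ?thesis using sign_changes_Suc[of ?m ?u] by simp
  qed
  show ?case
  proof (cases "x = 0 \<or> ?ys = []")
    case True
    then have "?u i * ?u ?m = 0" if "i < ?m" for i
      using that nth_mem[OF that] by (auto simp: filter_empty_conv nth_append)
    then have "?N = {}"
      by (intro equals0I) (elim CollectE exE conjE, simp only: less_irrefl)
    moreover have "?D (filter (\<lambda>x. x \<noteq> 0) (xs @ [x])) = ?D ?ys"
      using True by auto
    ultimately show ?thesis using snoc unfolding S by (simp only: Un_empty_right)
  next
    case False
    then obtain z where "z \<in> set xs" "z \<noteq> 0" by (auto simp: filter_empty_conv)
    then obtain as z bs where xs: "xs = as @ z # bs" "z \<noteq> 0" "\<forall>b\<in>set bs. b = 0"
      using split_list_last_prop[of xs "\<lambda>z. z \<noteq> 0"] by blast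
    let ?zs = "filter (\<lambda>x. x \<noteq> 0) as"
    have bs: "filter (\<lambda>x. x \<noteq> 0) bs = []"
      using xs(3) by (simp add: filter_empty_conv)
    have ys: "?ys = ?zs @ [z]"
      using xs bs by simp
    have a: "?u (length as) = z" "?u ?m = x"
      using xs by (simp_all add: nth_append)
    have b: "?u l = 0" if "length as < l" "l < ?m" for l
    proof -
      have "?u l = bs ! (l - Suc (length as))" "l - Suc (length as) < length bs"
        using that xs by (auto simp: nth_append nth_Cons')
      then show ?thesis using xs(3) nth_mem by metis
    qed
    have N: "?N = (if z * x < 0 then {(length as, ?m)} else {})"
    proof -
      have uniq: "i = length as" if "i < ?m" "?u i * ?u ?m < 0" "\<forall>l. i < l \<and> l < ?m \<longrightarrow> ?u l = 0" for i
      proof (rule ccontr)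
        assume "i \<noteq> length as"
        then consider "i < length as" | "length as < i" by linarith
        then show False
        proof cases
          case 1
          moreover have "length as < ?m" using xs(1) by simp
          ultimately have "?u (length as) = 0" using that(3) by blast
          then show False using a xs by simp
        next
          case 2
          then show False using b[OF 2 that(1)] that(2) by simp
        qed
      qed
      have "i < ?m \<and> ?u i * ?u ?m < 0 \<and> (\<forall>l. i < l \<and> l < ?m \<longrightarrow> ?u l = 0)
          \<longleftrightarrow> i = length as \<and> z * x < 0" for i
      proof (intro iffI)
        assume *: "i = length as \<and> z * x < 0"
        have "length as < ?m" using xs(1) by simp
        moreover have "?u (length as) * ?u ?m < 0" unfolding a using * by blast
        ultimately show "i < ?m \<and> ?u i * ?u ?m < 0 \<and> (\<forall>l. i < l \<and> l < ?m \<longrightarrow> ?u l = 0)"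
          using * b by blast
      next
        assume *: "i < ?m \<and> ?u i * ?u ?m < 0 \<and> (\<forall>l. i < l \<and> l < ?m \<longrightarrow> ?u l = 0)"
        have "i = length as" using * uniq by blast
        moreover from this have "z * x < 0" using * unfolding a by (simp only: a)
        ultimately show "i = length as \<and> z * x < 0" by blast
      qed
      then have "?N = {(i, ?m) |i. i = length as \<and> z * x < 0}"
        by (simp only:)
      then show ?thesis by auto
    qed
    have D: "?D (filter (\<lambda>x. x \<noteq> 0) (xs @ [x])) =
        ?D ?ys \<union> (if z * x < 0 then {length ?zs} else {})"
      using False unfolding filter_append ys by (auto simp: nth_append less_Suc_eq)
    have "?D ?ys \<inter> {length ?zs} = {}" "finite (?D ?ys)"
      unfolding ys by (auto intro: finite_subset[of _ "{..<Suc (length ?zs)}"])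
    moreover have "sign_changes {..<?m} (\<lambda>i. xs ! i) \<inter> {(length as, ?m)} = {}"
      "finite (sign_changes {..<?m} (\<lambda>i. xs ! i))"
      by (force simp: sign_changes_def, intro finite_sign_changes finite_lessThan)
    ultimately show ?thesis
      unfolding S N D using snoc by (auto simp: card_Un_disjoint)
  qed
qed

end

theory Submission
  imports Defs
begin

text \<open>Write \<open>V\<close> for the inverse of \<open>\<O>\<^sup>n\<close> and let \<open>M\<close> be the matrix with infinitely many rows \<open>c A\<^sup>t V\<close>,
  \<open>t \<ge> 0\<close>. The output started at \<open>x\<close> is \<open>y(t) = \<Sum>\<^sub>j M t j * (\<O>\<^sup>n x)\<^sub>j\<close>, so it is a linear combination of the
  \<open>n\<close> columns of \<open>M\<close>, whose first \<open>n\<close> rows form the identity. By the Cauchy-Binet formula the Markov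
  parameters of the triple \<open>(A_tilde A r, b_tilde A c r, c_tilde A c r)\<close> are minors of \<open>M\<close>: those formed
  by the last \<open>r\<close> columns and \<open>r\<close> consecutive rows, the first of which has index at least \<open>n - r\<close>
  (\<open>markov_parameter_eq_right_minor\<close>). External positivity therefore states the sign of all these
  minors.

  These minors are the discrete Wronskians (Casorati determinants) of the columns, taken from the right.
  As in Polya's criterion for disconjugacy of a linear differential equation, their signs bound the
  oscillation of every combination of the columns through repeated use of Rolle's theorem. For
  \<open>n \<ge> 2\<close> the last column \<open>w\<close> vanishes before time \<open>n - 1\<close> and is positive from then on. Replacing a
  sequence \<open>y\<close> from time \<open>n - 1\<close> on by \<open>y(t)/w(t) - y(t+1)/w(t+1)\<close>, and leaving it alone before,
  costs at most one sign change (\<open>alternates_difference\<close>) and annihilates \<open>w\<close>. What remains is a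
  combination of \<open>n - 1\<close> new columns, and these satisfy the hypotheses again, because their minors of
  order \<open>r\<close> are positive multiples of the old ones of order \<open>r + 1\<close> (\<open>right_minor_quotient_difference\<close>).
  After \<open>n - 1\<close> steps a multiple of a single nonnegative column is left, which has no sign change; hence
  \<open>y\<close> has at most \<open>n - 1\<close> of them (\<open>not_alternates_combination\<close>).\<close>

section \<open>Sign changes and alternation\<close>

text \<open>At least \<open>k\<close> sign changes. Unlike the pairs in \<^const>\<open>sign_changes\<close>, consecutive chosen indices may
  have nonzero entries in between, which makes the notion stable under moving them.\<close>
definition alternates :: "nat \<Rightarrow> (nat \<Rightarrow> real) \<Rightarrow> bool" where
  "alternates k u \<longleftrightarrow>
     (\<exists>\<sigma> i. (\<forall>j<k. i j < i (Suc j)) \<and> (\<forall>j\<le>k. 0 < \<sigma> * (-1) ^ j * u (i j)))"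

lemma alternates_mono: "alternates k u \<Longrightarrow> j \<le> k \<Longrightarrow> alternates j u"
  unfolding alternates_def by (elim exE conjE, intro exI conjI allI impI; force)

text \<open>Built up one entry at a time: the alternation always ends at the last nonzero entry read so far.
  A new nonzero entry of opposite sign extends it, one of the same sign replaces its last index.\<close>
lemma alternates_prefix:
  assumes "l < N" "u l \<noteq> 0"
  shows "alternates (card (sign_changes {..<N} u)) u"
proof -
  have "(\<forall>l<N. u l = 0) \<or> (\<exists>\<sigma> i k. k = card (sign_changes {..<N} u) \<and>
      (\<forall>j<k. i j < i (Suc j)) \<and> (\<forall>j\<le>k. 0 < \<sigma> * (-1) ^ j * u (i j)) \<and>
      i k < N \<and> (\<forall>l. i k < l \<and> l < N \<longrightarrow> u l = 0))"
  proof (induction N)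
    case 0
    show ?case by simp
  next
    case (Suc N)
    let ?new = "{(i, N) |i. i < N \<and> u i * u N < 0 \<and> (\<forall>l. i < l \<and> l < N \<longrightarrow> u l = 0)}"
    note S = sign_changes_Suc[of N u]
    consider (zero) "u N = 0" | (first) "u N \<noteq> 0" "\<forall>l<N. u l = 0"
      | (later) "u N \<noteq> 0" "\<not> (\<forall>l<N. u l = 0)" by blast
    then show ?case
    proof cases
      case zero
      then have "sign_changes {..<Suc N} u = sign_changes {..<N} u"
        unfolding S by auto
      note same = this
      from Suc.IH show ?thesis
      proof (elim disjE exE conjE)
        assume "\<forall>l<N. u l = 0"
        then show ?thesis using zero by (simp add: less_Suc_eq)
      next
        fix \<sigma> i k
        assume "k = card (sign_changes {..<N} u)" "\<forall>j<k. i j < i (Suc j)"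
          "\<forall>j\<le>k. 0 < \<sigma> * (-1) ^ j * u (i j)" "i k < N" "\<forall>l. i k < l \<and> l < N \<longrightarrow> u l = 0"
        then have "k = card (sign_changes {..<Suc N} u) \<and> (\<forall>j<k. i j < i (Suc j)) \<and>
          (\<forall>j\<le>k. 0 < \<sigma> * (-1) ^ j * u (i j)) \<and>
          i k < Suc N \<and> (\<forall>l. i k < l \<and> l < Suc N \<longrightarrow> u l = 0)"
          unfolding same using zero by (auto simp: less_Suc_eq)
        then show ?thesis by blast
      qed
    next
      case first
      have "sign_changes {..<Suc N} u = {}"
        using first by (fastforce simp: sign_changes_def less_Suc_eq)
      then have "0 = card (sign_changes {..<Suc N} u)" by simp
      moreover have "0 < sgn (u N) * (-1) ^ (0::nat) * u N"
        using first by (simp add: sgn_if)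
      ultimately have "\<exists>\<sigma> i k. k = card (sign_changes {..<Suc N} u) \<and>
        (\<forall>j<k. i j < i (Suc j)) \<and> (\<forall>j\<le>k. 0 < \<sigma> * (-1) ^ j * u (i j)) \<and>
        i k < Suc N \<and> (\<forall>l. i k < l \<and> l < Suc N \<longrightarrow> u l = 0)"
        by (intro exI[of _ "sgn (u N)"] exI[of _ "\<lambda>_. N"] exI[of _ 0]) auto
      then show ?thesis by blast
    next
      case later
      with Suc.IH obtain \<sigma> i k where k: "k = card (sign_changes {..<N} u)"
        and i: "\<forall>j<k. i j < i (Suc j)" "\<forall>j\<le>k. 0 < \<sigma> * (-1) ^ j * u (i j)"
        and ik: "i k < N" "\<forall>l. i k < l \<and> l < N \<longrightarrow> u l = 0" by blast
      have sk: "0 < \<sigma> * (-1) ^ k * u (i k)" using i(2) by blast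
      then have nz: "u (i k) \<noteq> 0" by auto
      have new: "?new = (if u (i k) * u N < 0 then {(i k, N)} else {})"
      proof -
        have "a = i k" if "a < N" "u a * u N < 0" "\<forall>l. a < l \<and> l < N \<longrightarrow> u l = 0" for a
        proof (rule linorder_cases[of a "i k"])
          assume "a < i k"
          then show ?thesis using that(3) ik(1) nz by blast
        next
          assume "i k < a"
          then have "u a = 0" using that(1) ik(2) by blast
          then show ?thesis using that(2) by simp
        qed
        then have "a < N \<and> u a * u N < 0 \<and> (\<forall>l. a < l \<and> l < N \<longrightarrow> u l = 0)
            \<longleftrightarrow> a = i k \<and> u (i k) * u N < 0" for a
          using ik by blast
        then have "?new = {(a, N) |a. a = i k \<and> u (i k) * u N < 0}"
          by (simp only:)
        then show ?thesis by auto
      qed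
      have fin: "finite (sign_changes {..<N} u)" by (simp add: finite_sign_changes)
      show ?thesis
      proof (cases "u (i k) * u N < 0")
        case True
        have notin: "(i k, N) \<notin> sign_changes {..<N} u" by (simp add: sign_changes_def)
        have card: "Suc k = card (sign_changes {..<Suc N} u)"
          unfolding S new using True fin notin k by simp
        have "0 < \<sigma> * (-1) ^ Suc k * u N"
          using sk True by (auto simp: zero_less_mult_iff mult_less_0_iff)
        then have "(\<forall>j<Suc k. (i(Suc k := N)) j < (i(Suc k := N)) (Suc j)) \<and>
          (\<forall>j\<le>Suc k. 0 < \<sigma> * (-1) ^ j * u ((i(Suc k := N)) j)) \<and>
          (i(Suc k := N)) (Suc k) < Suc N \<and>
          (\<forall>l. (i(Suc k := N)) (Suc k) < l \<and> l < Suc N \<longrightarrow> u l = 0)"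
          using i ik by (auto simp: less_Suc_eq le_Suc_eq)
        then show ?thesis using card by blast
      next
        case False
        have card: "k = card (sign_changes {..<Suc N} u)"
          unfolding S new using False k by simp
        have "0 < u (i k) * u N" using False nz later by (simp add: not_less less_le)
        then have "0 < \<sigma> * (-1) ^ k * u N"
          using sk by (auto simp: zero_less_mult_iff)
        moreover have "(i(k := N)) j < (i(k := N)) (Suc j)" if "j < k" for j
          using i(1) ik(1) that by (cases "Suc j = k") (auto intro: less_trans)
        ultimately have "(\<forall>j<k. (i(k := N)) j < (i(k := N)) (Suc j)) \<and>
          (\<forall>j\<le>k. 0 < \<sigma> * (-1) ^ j * u ((i(k := N)) j)) \<and>
          (i(k := N)) k < Suc N \<and>
          (\<forall>l. (i(k := N)) k < l \<and> l < Suc N \<longrightarrow> u l = 0)"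
          using i(2) by (auto simp: less_Suc_eq)
        then show ?thesis using card by blast
      qed
    qed
  qed
  then show ?thesis using assms unfolding alternates_def by blast
qed

lemma variation_le_if_not_alternates:
  assumes "\<not> alternates (Suc m) u"
  shows "seq_variation u \<le> ereal (real m)"
proof -
  have "finite (sign_changes UNIV u) \<and> card (sign_changes UNIV u) \<le> m"
  proof (rule ccontr)
    assume "\<not> ?thesis"
    then obtain F where F: "F \<subseteq> sign_changes UNIV u" "finite F" "card F = Suc m"
      by (metis not_less_eq_eq obtain_subset_with_card_n infinite_arbitrarily_large)
    have "finite (snd ` F)" using F(2) by simp
    then obtain N where N: "\<forall>x\<in>snd ` F. x < N" using finite_nat_set_iff_bounded by blast
    have "F \<subseteq> sign_changes {..<N} u"
    proof
      fix p assume p: "p \<in> F"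
      then have "snd p < N" using N by blast
      then show "p \<in> sign_changes {..<N} u"
        using p F(1) by (force simp: sign_changes_def)
    qed
    then have le: "Suc m \<le> card (sign_changes {..<N} u)"
      using F(3) card_mono[OF finite_sign_changes] by (metis finite_lessThan)
    then obtain a b where "(a, b) \<in> sign_changes {..<N} u"
      by (metis card.empty equals0I not_less_eq_eq surj_pair zero_le)
    then have "a < N" "u a \<noteq> 0" by (auto simp: sign_changes_def)
    from alternates_mono[OF alternates_prefix[of a N u, OF this] le] assms show False by simp
  qed
  moreover have "(- 1 :: ereal) \<le> ereal (real m)"
    by (simp add: one_ereal_def)
  ultimately show ?thesis by (simp add: variation_def)
qed

text \<open>Rolle's theorem for sequences. Between two chosen indices from \<open>m\<close> on, the differences of
  \<open>y / w\<close> telescope to a quantity that has the sign of the earlier entry, so one of them has this sign;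
  an index before \<open>m\<close> can be kept as it is. Keeping \<open>y\<close> below \<open>m\<close> is the limit,
  after rescaling row by row, of extending \<open>w\<close> below \<open>m\<close> by positive values that decrease ever more
  rapidly towards index 0.\<close>
lemma alternates_difference:
  fixes y z w :: "nat \<Rightarrow> real"
  assumes alt: "alternates (Suc k) y"
    and w: "\<And>t. m \<le> t \<Longrightarrow> 0 < w t"
    and z_low: "\<And>t. t < m \<Longrightarrow> z t = y t"
    and z_high: "\<And>t. m \<le> t \<Longrightarrow> z t = y t / w t - y (Suc t) / w (Suc t)"
  shows "alternates k z"
proof -
  obtain \<sigma> i where i: "\<And>j. j \<le> k \<Longrightarrow> i j < i (Suc j)"
    and s: "\<And>j. j \<le> Suc k \<Longrightarrow> 0 < \<sigma> * (-1) ^ j * y (i j)"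
    using alt unfolding alternates_def by (auto simp: less_Suc_eq_le)
  have "\<exists>t. i j \<le> t \<and> t < i (Suc j) \<and> 0 < \<sigma> * (-1) ^ j * z t" if j: "j \<le> k" for j
  proof (cases "i j < m")
    case True
    then show ?thesis using s[of j] i[OF j] z_low j by auto
  next
    case False
    let ?\<tau> = "\<sigma> * (-1) ^ j" and ?g = "\<lambda>t. y t / w t"
    have "(\<Sum>t = i j..<i (Suc j). ?\<tau> * z t) = ?\<tau> * (\<Sum>t = i j..<i (Suc j). - (?g (Suc t) - ?g t))"
      unfolding sum_distrib_left using False by (intro sum.cong) (auto simp: z_high)
    also have "\<dots> = ?\<tau> * ?g (i j) - ?\<tau> * ?g (i (Suc j))"
      unfolding sum_negf using i[OF j] by (subst sum_Suc_diff') (auto simp: algebra_simps)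
    also have "\<dots> > 0"
    proof -
      have "0 < ?\<tau> * y (i j) / w (i j)"
        using s[of j] w[of "i j"] False j by (intro divide_pos_pos) auto
      moreover have "0 < \<sigma> * (-1) ^ Suc j * y (i (Suc j)) / w (i (Suc j))"
        using s[of "Suc j"] w[of "i (Suc j)"] False j i[OF j] by (intro divide_pos_pos) auto
      ultimately show ?thesis by simp
    qed
    finally obtain t where "t \<in> {i j..<i (Suc j)}" "0 < ?\<tau> * z t"
      by (metis (mono_tags, lifting) not_le sum_nonpos)
    then show ?thesis by auto
  qed
  then obtain t where t: "\<And>j. j \<le> k \<Longrightarrow> i j \<le> t j \<and> t j < i (Suc j) \<and> 0 < \<sigma> * (-1) ^ j * z (t j)"
    by metis
  then have "\<forall>j<k. t j < t (Suc j)" by (meson Suc_leI less_imp_le less_le_trans)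
  with t show ?thesis unfolding alternates_def by blast
qed

section \<open>Reduction of the number of columns\<close>

definition right_minor :: "(nat \<Rightarrow> nat \<Rightarrow> real) \<Rightarrow> nat \<Rightarrow> nat \<Rightarrow> nat \<Rightarrow> real" where
  "right_minor M n r s = det (mat r r (\<lambda>(i, j). M (s + i) (n - r + j)))"

definition quotient_difference :: "nat \<Rightarrow> (nat \<Rightarrow> nat \<Rightarrow> real) \<Rightarrow> nat \<Rightarrow> nat \<Rightarrow> real" where
  "quotient_difference m M t j =
     (if t < m then M t j else M t j / M t m - M (Suc t) j / M (Suc t) m)"

text \<open>Row operations on the minor of order \<open>r + 1\<close>: the upper bidiagonal matrix \<open>T\<close> scales the rows
  from \<open>m\<close> on by \<open>1 / w\<close> and subtracts the next row, where \<open>w\<close> is column \<open>m\<close>. Its determinant is a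
  product of positive numbers. In \<open>T * B\<close> the last column is zero except for a \<open>1\<close> in the last row, and
  deleting this row and column leaves the quotient differences. The bound \<open>m \<le> s + r\<close> ensures that
  the last row is one in which \<open>w\<close> is positive.\<close>
lemma right_minor_quotient_difference:
  assumes zero: "\<And>t. t < m \<Longrightarrow> M t m = 0"
    and pos: "\<And>t. m \<le> t \<Longrightarrow> 0 < M t m"
    and r: "r \<le> m" and s: "m \<le> s + r"
  shows "\<exists>d>0. right_minor (quotient_difference m M) m r s = d * right_minor M (Suc m) (Suc r) s"
proof -
  define B where "B = mat (Suc r) (Suc r) (\<lambda>(i, j). M (s + i) (m - r + j))"
  define T where "T = mat (Suc r) (Suc r) (\<lambda>(i, j).
     if s + i < m then (if j = i then 1 else 0)
     else if j = i then 1 / M (s + i) m else if j = Suc i then - (1 / M (s + j) m) else 0)"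
  have carr: "B \<in> carrier_mat (Suc r) (Suc r)" "T \<in> carrier_mat (Suc r) (Suc r)"
    by (simp_all add: B_def T_def)
  have TB: "(T * B) $$ (i, j) = (if i < r then quotient_difference m M (s + i) (m - r + j)
      else M (s + i) (m - r + j) / M (s + i) m)" if "i \<le> r" "j \<le> r" for i j
  proof -
    have "(T * B) $$ (i, j) = (\<Sum>k<Suc r. T $$ (i, k) * B $$ (k, j))"
      using carr that by (simp add: scalar_prod_def lessThan_atLeast0)
    also have "\<dots> = (\<Sum>k<Suc r. (if k = i then T $$ (i, i) * B $$ (i, j) else 0)
        + (if k = Suc i then T $$ (i, Suc i) * B $$ (Suc i, j) else 0))"
      using that by (intro sum.cong) (auto simp: T_def)
    also have "\<dots> = T $$ (i, i) * B $$ (i, j)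
        + (if i < r then T $$ (i, Suc i) * B $$ (Suc i, j) else 0)"
      using that by (simp add: sum.distrib)
    also have "\<dots> = (if i < r then quotient_difference m M (s + i) (m - r + j)
        else M (s + i) (m - r + j) / M (s + i) m)"
      using that s by (auto simp: T_def B_def quotient_difference_def)
    finally show ?thesis .
  qed
  have last: "(T * B) $$ (i, r) = (if i = r then 1 else 0)" if "i \<le> r" for i
  proof -
    have nz: "M t m \<noteq> 0" if "m \<le> t" for t
      using pos[OF that] by simp
    show ?thesis
      using TB[OF that order_refl] that r s by (auto simp: quotient_difference_def zero nz not_less)
  qed
  have "det (T * B) = (\<Sum>i<Suc r. (T * B) $$ (i, r) * cofactor (T * B) i r)"
    using carr by (intro laplace_expansion_column) auto
  also have "\<dots> = (\<Sum>i<Suc r. if i = r then cofactor (T * B) r r else 0)"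
    by (intro sum.cong) (auto simp: last less_Suc_eq_le)
  also have "\<dots> = det (mat_delete (T * B) r r)"
    by (simp add: cofactor_def flip: mult_2)
  also have "mat_delete (T * B) r r = mat r r (\<lambda>(i, j). quotient_difference m M (s + i) (m - r + j))"
    using carr by (intro eq_matI) (auto simp: mat_delete_def TB simp del: index_mult_mat(1))
  finally have "right_minor (quotient_difference m M) m r s = det T * det B"
    using det_mult[OF carr(2,1)] by (simp add: right_minor_def)
  moreover have "det T > 0"
  proof -
    have "det T = prod_list (diag_mat T)"
      using carr(2) by (intro det_upper_triangular) (auto simp: T_def)
    also have "\<dots> = (\<Prod>i = 0..<Suc r. T $$ (i, i))"
      using carr by (simp add: prod_list_diag_prod)
    also have "\<dots> > 0"
      by (intro prod_pos) (auto simp: T_def pos)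
    finally show ?thesis .
  qed
  ultimately show ?thesis
    by (auto simp: right_minor_def B_def)
qed

text \<open>Induction on the number of columns: a quotient difference removes the last column and at most one
  alternation. Minors of order \<open>1\<close> give the positivity of the last column, on which the
  difference relies. In every step the order of a minor drops together with the number of columns, so
  those of full order stay of full order, and a weak sign suffices for them: at the end they are the
  entries of the single remaining column.\<close>
lemma not_alternates_combination:
  assumes "n \<ge> 1"
    and "\<And>t j. t < j \<Longrightarrow> j < n \<Longrightarrow> M t j = 0"
    and "\<And>r s. 1 \<le> r \<Longrightarrow> r < n \<Longrightarrow> n \<le> s + r \<Longrightarrow> 0 < right_minor M n r s"
    and "\<And>s. 0 \<le> right_minor M n n s"
  shows "\<not> alternates n (\<lambda>t. \<Sum>j<n. M t j * x j)"
  using assms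
proof (induction n arbitrary: M rule: dec_induct[of 1])
  case base
  have M: "0 \<le> M t 0" for t
    using base(3)[of t] by (simp add: right_minor_def det_single)
  show ?case
  proof
    assume "alternates 1 (\<lambda>t. \<Sum>j<1. M t j * x j)"
    then obtain \<sigma> i where "\<And>j. j \<le> 1 \<Longrightarrow> 0 < \<sigma> * (-1) ^ j * (M (i j) 0 * x 0)"
      unfolding alternates_def by auto
    from this[of 0] this[of 1] have "0 < M (i 0) 0 * (\<sigma> * x 0)" "M (i 1) 0 * (\<sigma> * x 0) < 0"
      by (auto simp: algebra_simps)
    then show False using M[of "i 0"] M[of "i 1"] by (auto simp: zero_less_mult_iff mult_less_0_iff)
  qed
next
  case (step m)
  have zero: "M t m = 0" if "t < m" for t
    using step.prems(1)[of t m] that by simp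
  have pos: "0 < M t m" if "m \<le> t" for t
    using step.prems(2)[of 1 t] step.hyps that by (simp add: right_minor_def det_single)
  let ?Q = "quotient_difference m M"
  let ?y = "\<lambda>t. \<Sum>j<Suc m. M t j * x j" and ?z = "\<lambda>t. \<Sum>j<m. ?Q t j * x j"
  have "\<not> alternates m ?z"
  proof (rule step.IH)
    show "?Q t j = 0" if "t < j" "j < m" for t j
      using that step.prems(1) by (simp add: quotient_difference_def)
    show "0 < right_minor ?Q m r s" if "1 \<le> r" "r < m" "m \<le> s + r" for r s
      using right_minor_quotient_difference[of m M r s, OF zero pos] that step.prems(2)[of "Suc r" s]
      by auto
    show "0 \<le> right_minor ?Q m m s" for s
      using right_minor_quotient_difference[of m M m s, OF zero pos] step.prems(3)[of s] by auto
  qed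
  moreover have "alternates m ?z" if "alternates (Suc m) ?y"
  proof (rule alternates_difference[OF that pos])
    show "?z t = ?y t" if "t < m" for t
      using that zero by (simp add: quotient_difference_def)
    show "?z t = ?y t / M t m - ?y (Suc t) / M (Suc t) m" if "m \<le> t" for t
      using that pos[of t] pos[of "Suc t"]
      by (simp add: quotient_difference_def add_divide_distrib sum_divide_distrib left_diff_distrib
          sum_subtractf)
  qed
  ultimately show ?case by blast
qed

section \<open>The Cauchy-Binet formula and compound matrices\<close>

text \<open>Each row of \<open>X * Y\<close> is a combination of the rows of \<open>Y\<close>. By multilinearity the determinant is a
  sum over the choices \<open>f\<close> of one row of \<open>Y\<close> per row of the product, and a choice with a repetition
  contributes nothing. An injective choice is an increasing list of row indices followed by a
  permutation; summing over the permutations gives the determinant of the columns of \<open>X\<close> that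
  belong to this list.\<close>
lemma cauchy_binet:
  fixes X Y :: "'a :: comm_ring_1 mat"
  assumes X: "X \<in> carrier_mat r q" and Y: "Y \<in> carrier_mat q r"
  shows "det (X * Y) = (\<Sum>L\<in>set (index_sets q r).
    det (mat r r (\<lambda>(i, j). X $$ (i, L ! j))) * det (mat r r (\<lambda>(i, j). Y $$ (L ! i, j))))"
proof -
  let ?F = "{f. (\<forall>i\<in>{0..<r}. f i \<in> {0..<q}) \<and> (\<forall>i. i \<notin> {0..<r} \<longrightarrow> f i = i)}"
  let ?inj = "{f \<in> ?F. inj_on f {0..<r}}"
  let ?P = "{p. p permutes {0..<r}}"
  let ?Y = "\<lambda>f. det (mat\<^sub>r r r (\<lambda>i. row Y (f i)))"
  let ?g = "\<lambda>f. (\<Prod>i = 0..<r. X $$ (i, f i)) * ?Y f"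
  let ?h = "\<lambda>(L, p) i. if i < r then L ! p i else (i :: nat)"
  have rows: "row Y k \<in> carrier_vec r" for k using Y by auto
  \<comment> \<open>Functions on \<open>{0..<r}\<close> are continued by the identity, like permutations of this set.\<close>
  have "det (X * Y) = (\<Sum>f\<in>?F. det (mat\<^sub>r r r (\<lambda>i. X $$ (i, f i) \<cdot>\<^sub>v row Y (f i))))"
    unfolding mat_mul_finsum_alt[OF X Y]
    by (rule det_linear_rows_sum) (use rows in auto)
  also have "\<dots> = (\<Sum>f\<in>?F. ?g f)"
    by (intro sum.cong refl det_rows_mul) (use rows in auto)
  also have "\<dots> = (\<Sum>f\<in>?inj. ?g f)"
  proof (rule sum.mono_neutral_right)
    show "finite ?F" by (rule finite_bounded_functions) auto
    show "\<forall>f\<in>?F - ?inj. ?g f = 0"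
    proof
      fix f assume "f \<in> ?F - ?inj"
      then obtain i j where ij: "i < r" "j < r" "i \<noteq> j" "f i = f j"
        by (auto simp: inj_on_def)
      have "?Y f = 0"
        by (rule det_identical_rows[of _ r i j]) (use ij rows in auto)
      then show "?g f = 0" by simp
    qed
  qed auto
  also have "\<dots> = (\<Sum>Lp\<in>set (index_sets q r) \<times> ?P. ?g (?h Lp))"
  proof (rule sum.reindex_bij_betw[symmetric], rule bij_betwI')
    fix Lp Mq assume "Lp \<in> set (index_sets q r) \<times> ?P" "Mq \<in> set (index_sets q r) \<times> ?P"
    then obtain L p M p' where Lp: "Lp = (L, p)" "Mq = (M, p')"
      and L: "sorted_wrt (<) L" "length L = r" and M: "sorted_wrt (<) M" "length M = r"
      and p: "p permutes {0..<r}" and p': "p' permutes {0..<r}"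
      by (auto simp: set_index_sets)
    show "?h Lp = ?h Mq \<longleftrightarrow> Lp = Mq"
    proof
      assume eq: "?h Lp = ?h Mq"
      have eq': "L ! p i = M ! p' i" if "i < r" for i
        using fun_cong[OF eq, of i] that Lp by simp
      have im: "set K = (\<lambda>i. K ! \<pi> i) ` {0..<r}"
        if "length K = r" "\<pi> permutes {0..<r}" for K :: "nat list" and \<pi>
      proof -
        have "set K = (!) K ` (\<pi> ` {0..<r})"
          unfolding permutes_image[OF that(2)] using that(1) by (auto simp: set_conv_nth)
        then show ?thesis by (simp add: image_image)
      qed
      have "set L = set M"
        unfolding im[OF L(2) p] im[OF M(2) p'] using eq' by auto
      then have LM: "L = M"
        using L M by (auto intro: sorted_distinct_set_unique simp: strict_sorted_iff)
      have "p i = p' i" for i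
      proof (cases "i < r")
        case True
        then have "p i < r" "p' i < r"
          using permutes_in_image[OF p, of i] permutes_in_image[OF p', of i] by auto
        then show ?thesis
          using eq'[OF True] L by (simp add: LM strict_sorted_iff nth_eq_iff_index_eq)
      next
        case False
        then show ?thesis using p p' by (simp add: permutes_def)
      qed
      with Lp LM show "Lp = Mq" by auto
    qed simp
  next
    fix Lp assume "Lp \<in> set (index_sets q r) \<times> ?P"
    then obtain L p where Lp: "Lp = (L, p)"
      and L: "sorted_wrt (<) L" "length L = r" "set L \<subseteq> {..<q}" and p: "p permutes {0..<r}"
      by (auto simp: set_index_sets)
    have pr: "p i < r" if "i < r" for i
      using permutes_in_image[OF p, of i] that by auto
    have "L ! p i < q" if "i < r" for i
      using L(2,3) pr[OF that] nth_mem by blast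
    moreover have "i = j" if "i < r" "j < r" "L ! p i = L ! p j" for i j
    proof -
      have "p i = p j"
        using that pr L by (simp add: strict_sorted_iff nth_eq_iff_index_eq)
      then show ?thesis by (rule injD[OF permutes_inj[OF p]])
    qed
    ultimately show "?h Lp \<in> ?inj" by (auto simp: Lp inj_on_def)
  next
    fix f assume f: "f \<in> ?inj"
    define L where "L = sorted_list_of_set (f ` {0..<r})"
    have setL: "set L = f ` {0..<r}" and dL: "distinct L" and lenL: "length L = r"
      using f by (simp_all add: L_def card_image)
    have L: "L \<in> set (index_sets q r)"
      using f lenL setL by (auto simp: set_index_sets L_def strict_sorted_list_of_set)
    have bij: "bij_betw ((!) L) {0..<r} (f ` {0..<r})"
      using bij_betw_nth[OF dL, of "{0..<r}" "f ` {0..<r}"] lenL setL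
      by (simp add: lessThan_atLeast0)
    define p where "p i = (if i < r then inv_into {0..<r} ((!) L) (f i) else i)" for i
    have pr: "p i < r \<and> L ! p i = f i" if "i < r" for i
    proof -
      have fi: "f i \<in> (!) L ` {0..<r}" using bij that by (auto simp: bij_betw_def)
      show ?thesis
        using inv_into_into[OF fi] f_inv_into_f[OF fi] that by (simp add: p_def)
    qed
    have "p permutes {0..<r}"
    proof (rule inj_on_nat_permutes)
      show "inj_on p {0..<r}"
      proof
        fix i j assume "i \<in> {0..<r}" "j \<in> {0..<r}" "p i = p j"
        then have "i \<in> {0..<r}" "j \<in> {0..<r}" "f i = f j" using pr[of i] pr[of j] by auto
        then show "i = j" using f by (auto dest: inj_onD)
      qed
    qed (use pr in \<open>auto simp: p_def\<close>)
    moreover have "f = ?h (L, p)"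
      using f pr by (auto simp: fun_eq_iff)
    ultimately show "\<exists>Lp\<in>set (index_sets q r) \<times> ?P. f = ?h Lp"
      using L by blast
  qed
  also have "\<dots> = (\<Sum>L\<in>set (index_sets q r). \<Sum>p\<in>?P. ?g (?h (L, p)))"
    unfolding sum.cartesian_product by (rule sum.cong) auto
  also have "\<dots> = (\<Sum>L\<in>set (index_sets q r).
    det (mat r r (\<lambda>(i, j). X $$ (i, L ! j))) * det (mat r r (\<lambda>(i, j). Y $$ (L ! i, j))))"
  proof (rule sum.cong[OF refl])
    fix L assume "L \<in> set (index_sets q r)"
    then have L: "length L = r" "set L \<subseteq> {..<q}" by (auto simp: set_index_sets)
    let ?XL = "mat r r (\<lambda>(i, j). X $$ (i, L ! j))" and ?YL = "mat r r (\<lambda>(i, j). Y $$ (L ! i, j))"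
    have "?g (?h (L, p)) = signof p * (\<Prod>i = 0..<r. ?XL $$ (i, p i)) * det ?YL" if p: "p \<in> ?P" for p
    proof -
      have p: "p permutes {0..<r}" using p by simp
      have pr: "p i < r" if "i < r" for i
        using permutes_in_image[OF p, of i] that by auto
      have Lq: "L ! i < q" if "i < r" for i
        using L that nth_mem by blast
      have "mat\<^sub>r r r (\<lambda>i. row Y (?h (L, p) i)) = mat r r (\<lambda>(i, j). ?YL $$ (p i, j))"
        using Y pr Lq by (intro eq_matI) auto
      then have "?Y (?h (L, p)) = signof p * det ?YL"
        using det_permute_rows[OF _ p, of ?YL] by simp
      moreover have "(\<Prod>i = 0..<r. X $$ (i, ?h (L, p) i)) = (\<Prod>i = 0..<r. ?XL $$ (i, p i))"
        using pr by (intro prod.cong) auto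
      ultimately show ?thesis by simp
    qed
    then have "(\<Sum>p\<in>?P. ?g (?h (L, p)))
      = (\<Sum>p\<in>?P. signof p * (\<Prod>i = 0..<r. ?XL $$ (i, p i))) * det ?YL"
      unfolding sum_distrib_right by (intro sum.cong refl) blast
    also have "\<dots> = det ?XL * det ?YL"
      by (subst det_def'[of ?XL r]) auto
    finally show "(\<Sum>p\<in>?P. ?g (?h (L, p))) = det ?XL * det ?YL" .
  qed
  finally show ?thesis .
qed

lemma pick_set_sorted:
  assumes "sorted_wrt (<) L" "a < length L"
  shows "pick (set L) a = L ! a"
proof -
  have "{x \<in> set L. x < L ! a} = set (take a L)"
  proof (intro equalityI subsetI)
    fix x assume "x \<in> {x \<in> set L. x < L ! a}"
    then obtain b where b: "b < length L" "x = L ! b" "L ! b < L ! a"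
      by (auto simp: set_conv_nth)
    have "b < a"
      using b assms sorted_wrt_nth_less[OF assms(1), of a b] by (metis less_asym linorder_neqE_nat)
    then show "x \<in> set (take a L)" using b assms(2) by (auto simp: in_set_conv_nth)
  next
    fix x assume "x \<in> set (take a L)"
    then have "x \<in> set L" "\<exists>b<a. x = L ! b"
      using assms(2) by (auto dest: in_set_takeD simp: in_set_conv_nth[of x "take a L"])
    then show "x \<in> {x \<in> set L. x < L ! a}"
      using assms(2) sorted_wrt_nth_less[OF assms(1)] by auto
  qed
  then have "card {x \<in> set L. x < L ! a} = a"
    using assms by (simp add: distinct_card strict_sorted_iff)
  then show ?thesis using pick_card_in_set[of "L ! a" "set L"] assms(2) by simp
qed

lemma submatrix_index_sets:
  assumes "X \<in> carrier_mat p q" "I \<in> set (index_sets p r)" "J \<in> set (index_sets q r)"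
  shows "submatrix X (set I) (set J) = mat r r (\<lambda>(a, b). X $$ (I ! a, J ! b))"
proof -
  have I: "sorted_wrt (<) I" "length I = r" and J: "sorted_wrt (<) J" "length J = r"
    and sub: "set I \<subseteq> {..<p}" "set J \<subseteq> {..<q}"
    using assms by (auto simp: set_index_sets)
  have "{i. i < p \<and> i \<in> set I} = set I" "{j. j < q \<and> j \<in> set J} = set J"
    using sub by auto
  then have "card {i. i < dim_row X \<and> i \<in> set I} = r" "card {j. j < dim_col X \<and> j \<in> set J} = r"
    using assms(1) I J by (auto simp: strict_sorted_iff distinct_card)
  then show ?thesis
    using I J by (intro eq_matI) (auto simp: dim_submatrix submatrix_index pick_set_sorted)
qed

lemma compound_carrier: "X \<in> carrier_mat p q \<Longrightarrow> compound r X \<in> carrier_mat (p choose r) (q choose r)"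
  by (auto simp: compound_def)

lemma index_sets_nth: "k < p choose r \<Longrightarrow> index_sets p r ! k \<in> set (index_sets p r)"
  by (simp add: length_index_sets)

lemma index_sets_less:
  assumes "L \<in> set (index_sets q r)" "a < r"
  shows "L ! a < q"
proof -
  have "set L \<subseteq> {..<q}" "L ! a \<in> set L"
    using assms by (auto simp: set_index_sets)
  then show ?thesis by auto
qed

lemma compound_index:
  assumes "X \<in> carrier_mat p q" "i < p choose r" "j < q choose r"
  shows "compound r X $$ (i, j)
    = det (mat r r (\<lambda>(a, b). X $$ (index_sets p r ! i ! a, index_sets q r ! j ! b)))"
  using assms submatrix_index_sets[OF assms(1) index_sets_nth index_sets_nth, of i r j]
  by (simp add: compound_def)

text \<open>Multiplicativity of compounds is the Cauchy-Binet formula applied to the rows of \<open>X\<close> and the columns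
  of \<open>Y\<close> that are selected by the two index sets.\<close>
lemma compound_mult:
  assumes X: "X \<in> carrier_mat p q" and Y: "Y \<in> carrier_mat q s"
  shows "compound r (X * Y) = compound r X * compound r Y"
proof (rule eq_matI)
  have XY: "X * Y \<in> carrier_mat p s" using X Y by simp
  note carr = compound_carrier[OF X, of r] compound_carrier[OF Y, of r] compound_carrier[OF XY, of r]
  show "dim_row (compound r (X * Y)) = dim_row (compound r X * compound r Y)"
    and "dim_col (compound r (X * Y)) = dim_col (compound r X * compound r Y)"
    using carr by auto
  fix i j assume "i < dim_row (compound r X * compound r Y)" "j < dim_col (compound r X * compound r Y)"
  then have i: "i < p choose r" and j: "j < s choose r" using carr by auto
  let ?I = "index_sets p r ! i" and ?J = "index_sets s r ! j" and ?K = "\<lambda>k. index_sets q r ! k"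
  have I: "?I ! a < p" and J: "?J ! a < s" if "a < r" for a
    using index_sets_less[OF index_sets_nth that] i j by auto
  define X' where "X' = mat r q (\<lambda>(a, k). X $$ (?I ! a, k))"
  define Y' where "Y' = mat q r (\<lambda>(k, b). Y $$ (k, ?J ! b))"
  have "distinct (index_sets q r)"
    unfolding index_sets_def using distinct_set_subseqs[of "[0..<q]"] by (simp add: distinct_map)
  then have bij: "bij_betw ?K {..<q choose r} (set (index_sets q r))"
    by (intro bij_betw_nth) (simp_all add: length_index_sets)
  have "compound r (X * Y) $$ (i, j) = det (mat r r (\<lambda>(a, b). (X * Y) $$ (?I ! a, ?J ! b)))"
    by (rule compound_index[OF XY i j])
  also have "mat r r (\<lambda>(a, b). (X * Y) $$ (?I ! a, ?J ! b)) = X' * Y'"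
    using X Y I J by (intro eq_matI) (auto simp: X'_def Y'_def scalar_prod_def intro!: sum.cong)
  also have "det (X' * Y') = (\<Sum>L\<in>set (index_sets q r).
      det (mat r r (\<lambda>(i, j). X' $$ (i, L ! j))) * det (mat r r (\<lambda>(i, j). Y' $$ (L ! i, j))))"
    by (rule cauchy_binet) (simp_all add: X'_def Y'_def)
  also have "\<dots> = (\<Sum>L\<in>set (index_sets q r).
      det (mat r r (\<lambda>(a, b). X $$ (?I ! a, L ! b))) * det (mat r r (\<lambda>(a, b). Y $$ (L ! a, ?J ! b))))"
    by (intro sum.cong refl arg_cong2[of _ _ _ _ "(*)"] arg_cong[of _ _ det] eq_matI)
      (auto simp: X'_def Y'_def index_sets_less)
  also have "\<dots> = (\<Sum>k<q choose r. compound r X $$ (i, k) * compound r Y $$ (k, j))"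
    unfolding sum.reindex_bij_betw[OF bij, symmetric]
    by (intro sum.cong refl) (simp add: compound_index[OF X i] compound_index[OF Y _ j])
  also have "\<dots> = (compound r X * compound r Y) $$ (i, j)"
    using carr i j by (simp add: scalar_prod_def lessThan_atLeast0)
  finally show "compound r (X * Y) $$ (i, j) = (compound r X * compound r Y) $$ (i, j)" .
qed

lemma compound_full:
  assumes X: "X \<in> carrier_mat r r"
  shows "compound r X $$ (0, 0) = det X"
proof -
  have "index_sets r r ! 0 \<in> set (index_sets r r)"
    by (intro index_sets_nth) simp
  then have I: "sorted_wrt (<) (index_sets r r ! 0)" "set (index_sets r r ! 0) \<subseteq> {..<r}"
    "length (index_sets r r ! 0) = r"
    by (auto simp: set_index_sets)
  then have "set (index_sets r r ! 0) = {..<r}"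
    by (intro card_subset_eq) (auto simp: strict_sorted_iff distinct_card)
  then have "index_sets r r ! 0 = [0..<r]"
    using I(1) by (intro sorted_distinct_set_unique) (simp_all add: strict_sorted_iff lessThan_atLeast0)
  moreover have "mat r r (\<lambda>(a, b). X $$ ([0..<r] ! a, [0..<r] ! b)) = X"
    using X by (intro eq_matI) auto
  ultimately show ?thesis
    using compound_index[OF X, of 0 r 0] by simp
qed

lemma compound_mult_pow:
  assumes X: "X \<in> carrier_mat p n" and A: "A \<in> carrier_mat n n"
  shows "compound r X * compound r A ^\<^sub>m k = compound r (X * A ^\<^sub>m k)"
proof (induction k)
  case 0
  show ?case using compound_carrier[OF X, of r] compound_carrier[OF A, of r] X A by simp
next
  case (Suc k)
  note carr = compound_carrier[OF X, of r] compound_carrier[OF A, of r]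
  have "compound r X * compound r A ^\<^sub>m Suc k = compound r X * compound r A ^\<^sub>m k * compound r A"
    using carr by (simp add: assoc_mult_mat[of _ _ "n choose r" _ "n choose r" _ "n choose r"])
  also have "\<dots> = compound r (X * A ^\<^sub>m k * A)"
    unfolding Suc using X A by (subst compound_mult) auto
  also have "X * A ^\<^sub>m k * A = X * A ^\<^sub>m Suc k"
    using X A by (simp add: assoc_mult_mat[of _ p n _ n _ n])
  finally show ?case .
qed

section \<open>The observability operator in coordinates of its first outputs\<close>

lemma pow_mat_add:
  assumes "A \<in> carrier_mat n n"
  shows "A ^\<^sub>m i * A ^\<^sub>m k = A ^\<^sub>m (i + k)"
proof (induction k)
  case (Suc k)
  then show ?case
    using assms by (simp flip: assoc_mult_mat[of _ n n _ n _ n])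
qed (use assms in simp)

lemma obs_matrix_carrier: "c \<in> carrier_mat 1 n \<Longrightarrow> obs_matrix A c r \<in> carrier_mat r n"
  by (auto simp: obs_matrix_def)

lemma row_obs_matrix:
  assumes "A \<in> carrier_mat n n" "c \<in> carrier_mat 1 n" "i < r"
  shows "row (obs_matrix A c r) i = row (c * A ^\<^sub>m i) 0"
proof -
  have "c * A ^\<^sub>m i \<in> carrier_mat 1 n" using assms by simp
  then have "row (c * A ^\<^sub>m i) 0 \<in> carrier_vec n"
    by (rule row_carrier_vec[rotated]) simp
  then show ?thesis
    using assms(2,3) unfolding obs_matrix_def by (subst mat_of_rows_row) auto
qed

lemma obs_matrix_mult:
  assumes "A \<in> carrier_mat n n" "c \<in> carrier_mat 1 n" "Y \<in> carrier_mat n q" "i < r" "j < q"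
  shows "(obs_matrix A c r * Y) $$ (i, j) = (c * A ^\<^sub>m i * Y) $$ (0, j)"
  using assms obs_matrix_carrier[OF assms(2), of A r]
  by (simp add: row_obs_matrix[OF assms(1,2,4)])

text \<open>The factor \<open>(0, I\<^sub>r)\<^sup>T\<close> of \<^const>\<open>b_tilde\<close> selects the last \<open>r\<close> columns.\<close>
lemma zero_over_one_mult:
  fixes W :: "real mat"
  assumes W: "W \<in> carrier_mat p n" and "r \<le> n" "i < p" "j < r"
  shows "(W * (0\<^sub>m (n - r) r @\<^sub>r 1\<^sub>m r)) $$ (i, j) = W $$ (i, n - r + j)"
proof -
  let ?E = "0\<^sub>m (n - r) r @\<^sub>r 1\<^sub>m r :: real mat"
  have E: "?E \<in> carrier_mat n r"
    using carrier_append_rows[of "0\<^sub>m (n - r) r" "n - r" r "1\<^sub>m r" r] assms(2) by simp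
  have "(W * ?E) $$ (i, j) = (\<Sum>k = 0..<n. W $$ (i, k) * ?E $$ (k, j))"
    using W E assms by (simp add: scalar_prod_def)
  also have "\<dots> = (\<Sum>k = 0..<n. if k = n - r + j then W $$ (i, k) else 0)"
    using assms by (intro sum.cong) (auto simp: append_rows_def)
  also have "\<dots> = W $$ (i, n - r + j)"
    using assms by simp
  finally show ?thesis .
qed

text \<open>By multiplicativity the product of compounds is the compound of
  \<open>\<O>\<^sup>r A\<^sup>k A\<^sup>n\<^sup>-\<^sup>r V (0, I\<^sub>r)\<^sup>T\<close>, an \<open>r \<times> r\<close> matrix, so that its only entry is a determinant. Row \<open>i\<close> of that
  matrix belongs to time \<open>k + (n - r) + i\<close>.\<close>
lemma markov_parameter_eq_right_minor:
  assumes A: "A \<in> carrier_mat n n" and c: "c \<in> carrier_mat 1 n"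
    and V: "V \<in> carrier_mat n n" "mat_inverse (obs_matrix A c n) = Some V" and r: "r \<le> n"
  shows "(c_tilde A c r * A_tilde A r ^\<^sub>m k * b_tilde A c r) $$ (0, 0)
    = right_minor (\<lambda>t j. (c * A ^\<^sub>m t * V) $$ (0, j)) n r (k + (n - r))"
proof -
  let ?E = "0\<^sub>m (n - r) r @\<^sub>r 1\<^sub>m r :: real mat" and ?O = "obs_matrix A c r"
  have E: "?E \<in> carrier_mat n r"
    using carrier_append_rows[of "0\<^sub>m (n - r) r" "n - r" r "1\<^sub>m r" r] r by simp
  have O: "?O \<in> carrier_mat r n" by (rule obs_matrix_carrier[OF c])
  have P: "A ^\<^sub>m k \<in> carrier_mat n n" for k using A by simp
  define B where "B = A ^\<^sub>m (n - r) * V * ?E"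
  have B: "B \<in> carrier_mat n r" using P[of "n - r"] V E by (simp add: B_def)
  have "b_tilde A c r = compound r B"
    using A V(2) by (simp add: b_tilde_def B_def Let_def)
  then have "c_tilde A c r * A_tilde A r ^\<^sub>m k * b_tilde A c r = compound r (?O * A ^\<^sub>m k * B)"
    unfolding c_tilde_def A_tilde_def compound_mult_pow[OF O A]
    using compound_mult[of "?O * A ^\<^sub>m k" r n B r r] O P[of k] B by simp
  also have "\<dots> $$ (0, 0) = det (?O * A ^\<^sub>m k * B)"
    by (rule compound_full) (use O P[of k] B in simp)
  also have "?O * A ^\<^sub>m k * B
    = mat r r (\<lambda>(i, j). (c * A ^\<^sub>m (k + (n - r) + i) * V) $$ (0, n - r + j))"
  proof (rule eq_matI)
    fix i j assume "i < dim_row (mat r r (\<lambda>(i, j). (c * A ^\<^sub>m (k + (n - r) + i) * V) $$ (0, n - r + j)))"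
      "j < dim_col (mat r r (\<lambda>(i, j). (c * A ^\<^sub>m (k + (n - r) + i) * V) $$ (0, n - r + j)))"
    then have ij: "i < r" "j < r" by simp_all
    have "(?O * A ^\<^sub>m k * B) $$ (i, j) = (?O * (A ^\<^sub>m k * B)) $$ (i, j)"
      using O P[of k] B by (simp add: assoc_mult_mat[of _ r n _ n _ r])
    also have "\<dots> = (c * A ^\<^sub>m i * (A ^\<^sub>m k * B)) $$ (0, j)"
      by (rule obs_matrix_mult[OF A c _ ij]) (use P[of k] B in simp)
    also have "c * A ^\<^sub>m i * (A ^\<^sub>m k * B) = c * (A ^\<^sub>m i * A ^\<^sub>m k * A ^\<^sub>m (n - r)) * V * ?E"
      using c P[of i] P[of k] P[of "n - r"] V(1) E unfolding B_def
      by (simp add: assoc_mult_mat[of _ 1 n _ n _ n] assoc_mult_mat[of _ 1 n _ n _ r]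
          assoc_mult_mat[of _ n n _ n _ n] assoc_mult_mat[of _ n n _ n _ r] del: index_mult_mat)
    also have "A ^\<^sub>m i * A ^\<^sub>m k * A ^\<^sub>m (n - r) = A ^\<^sub>m (k + (n - r) + i)"
      by (simp add: pow_mat_add[OF A] ac_simps)
    also have "(c * A ^\<^sub>m (k + (n - r) + i) * V * ?E) $$ (0, j)
        = (c * A ^\<^sub>m (k + (n - r) + i) * V) $$ (0, n - r + j)"
      by (rule zero_over_one_mult[where p = 1]) (use c P V r ij in auto)
    finally show "(?O * A ^\<^sub>m k * B) $$ (i, j)
        = mat r r (\<lambda>(i, j). (c * A ^\<^sub>m (k + (n - r) + i) * V) $$ (0, n - r + j)) $$ (i, j)"
      using ij by simp
  qed (use O B in auto)
  finally show ?thesis by (simp add: right_minor_def)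
qed

text \<open>The output depends linearly on its first \<open>n\<close> values \<open>\<O>\<^sup>n x\<close>, since these determine \<open>x\<close>.\<close>
lemma obs_operator_combination:
  assumes A: "A \<in> carrier_mat n n" and c: "c \<in> carrier_mat 1 n"
    and V: "V \<in> carrier_mat n n" "V * obs_matrix A c n = 1\<^sub>m n" and x: "x \<in> carrier_vec n"
  shows "obs_operator A c x
    = (\<lambda>t. \<Sum>j<n. (c * A ^\<^sub>m t * V) $$ (0, j) * (obs_matrix A c n *\<^sub>v x) $ j)"
proof
  fix t
  let ?O = "obs_matrix A c n"
  have O: "?O \<in> carrier_mat n n" by (rule obs_matrix_carrier[OF c])
  have C: "c * A ^\<^sub>m t \<in> carrier_mat 1 n" using A c by simp
  have "x = V *\<^sub>v (?O *\<^sub>v x)"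
    using V O x by (simp flip: assoc_mult_mat_vec)
  then have "obs_operator A c x t = ((c * A ^\<^sub>m t) *\<^sub>v (V *\<^sub>v (?O *\<^sub>v x))) $ 0"
    by (simp add: obs_operator_def)
  also have "\<dots> = ((c * A ^\<^sub>m t * V) *\<^sub>v (?O *\<^sub>v x)) $ 0"
    using C V(1) O x by (simp add: assoc_mult_mat_vec[of _ 1 n _ n])
  also have "\<dots> = (\<Sum>j<n. (c * A ^\<^sub>m t * V) $$ (0, j) * (?O *\<^sub>v x) $ j)"
  proof -
    have W: "c * A ^\<^sub>m t * V \<in> carrier_mat 1 n" using C V(1) by simp
    have v: "?O *\<^sub>v x \<in> carrier_vec n" using O x by simp
    show ?thesis
      using carrier_matD[OF W] carrier_vecD[OF v]
      by (simp add: scalar_prod_def lessThan_atLeast0 del: index_mult_mat(1))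
  qed
  finally show "obs_operator A c x t
      = (\<Sum>j<n. (c * A ^\<^sub>m t * V) $$ (0, j) * (?O *\<^sub>v x) $ j)" .
qed

lemma observable_mat_inverse:
  assumes A: "A \<in> carrier_mat n n" and c: "c \<in> carrier_mat 1 n" and "observable A c"
  obtains V where "mat_inverse (obs_matrix A c n) = Some V" "V \<in> carrier_mat n n"
    "obs_matrix A c n * V = 1\<^sub>m n" "V * obs_matrix A c n = 1\<^sub>m n"
proof -
  let ?O = "obs_matrix A c n"
  have O: "?O \<in> carrier_mat n n" by (rule obs_matrix_carrier[OF c])
  obtain W where W: "?O * W = 1\<^sub>m n" "W * ?O = 1\<^sub>m (dim_row W)"
    using assms O by (auto simp: observable_def invertible_mat_def inverts_mat_def)
  then have "W \<in> carrier_mat n n"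
    using O by (metis carrier_mat_triv carrier_matD(2) index_mult_mat(2,3) index_one_mat(2,3))
  then have "?O \<in> Units (ring_mat TYPE(real) n n)"
    using O W by (auto simp: Units_def ring_mat_def)
  then obtain V where "mat_inverse ?O = Some V"
    using mat_inverse(1)[OF O, where b = n] by (cases "mat_inverse ?O") auto
  then show thesis using that mat_inverse(2)[OF O] by blast
qed

theorem proposition12:
  fixes A c :: "real mat" and n :: nat
  assumes "n \<ge> 1"
    and "A \<in> carrier_mat n n" and "c \<in> carrier_mat 1 n"
    and "observable A c"
    and "\<And>r. r \<in> {1..n - 1} \<Longrightarrow>
           strictly_externally_positive (A_tilde A r) (b_tilde A c r) (c_tilde A c r)"
    and "externally_positive (A_tilde A n) (b_tilde A c n) (c_tilde A c n)"
    and "\<And>l. l \<in> {1..n - 1} \<Longrightarrow>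
           (c_tilde A c n * (A_tilde A n ^\<^sub>m (l - 1)) * b_tilde A c n) $$ (0, 0) > 0"
  shows "variation_bounding n (n - 1) (obs_operator A c)"
proof -
  note A = assms(2) and c = assms(3)
  let ?O = "obs_matrix A c n"
  obtain V where V: "V \<in> carrier_mat n n" "mat_inverse ?O = Some V"
    and OV: "?O * V = 1\<^sub>m n" and VO: "V * ?O = 1\<^sub>m n"
    using observable_mat_inverse[OF A c assms(4)] by metis
  define M where "M t j = (c * A ^\<^sub>m t * V) $$ (0, j)" for t j
  have markov: "(c_tilde A c r * A_tilde A r ^\<^sub>m k * b_tilde A c r) $$ (0, 0)
      = right_minor M n r (k + (n - r))" if "r \<le> n" for r k
    using markov_parameter_eq_right_minor[OF A c V that] unfolding M_def .
  have "\<not> alternates n (\<lambda>t. \<Sum>j<n. M t j * y j)" for y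
  proof (rule not_alternates_combination[OF assms(1)])
    \<comment> \<open>The first \<open>n\<close> rows of \<open>M\<close> are \<open>\<O>\<^sup>n V = I\<close>.\<close>
    fix t j :: nat assume tj: "t < j" "j < n"
    then have "M t j = (?O * V) $$ (t, j)"
      unfolding M_def using obs_matrix_mult[OF A c V(1), of t n j] by simp
    with OV tj show "M t j = 0" by simp
  next
    \<comment> \<open>Rows that start at \<open>s\<close> belong to the Markov parameter with exponent \<open>s - (n - r)\<close>.\<close>
    fix r s assume r: "1 \<le> r" "r < n" "n \<le> s + r"
    have "strictly_externally_positive (A_tilde A r) (b_tilde A c r) (c_tilde A c r)"
      using assms(5) r by simp
    then have "0 < (c_tilde A c r * A_tilde A r ^\<^sub>m (Suc (s + r - n) - 1) * b_tilde A c r) $$ (0, 0)"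
      unfolding strictly_externally_positive_def using le_add1[of 1] by (metis Suc_eq_plus1_left)
    then show "0 < right_minor M n r s"
      using markov[of r "s + r - n"] r by simp
  next
    fix s
    have "0 \<le> (c_tilde A c n * A_tilde A n ^\<^sub>m (Suc s - 1) * b_tilde A c n) $$ (0, 0)"
      using assms(6) unfolding externally_positive_def by (metis Suc_eq_plus1_left le_add1)
    then show "0 \<le> right_minor M n n s"
      using markov[of n s] by simp
  qed
  then have "\<not> alternates (Suc (n - 1)) (obs_operator A c x)" if "x \<in> carrier_vec n" for x
    unfolding obs_operator_combination[OF A c V(1) VO that] M_def using assms(1) by simp
  then show ?thesis
    unfolding variation_bounding_def by (blast intro: variation_le_if_not_alternates)
qed

end
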